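(* For sCCS-PDL processes $P$ and $Q$ and a proposition symbol $p$: $\overrightarrow{{\cal R}_f}(P) = \overrightarrow{{\cal R}_f}(Q)$ if and only if $\Vdash \langle P \rangle p \leftrightarrow \langle Q \rangle p$.
   Context: sCCS-PDL formulas: $\varphi ::= p \mid \top \mid \neg \varphi \mid \varphi_1 \land \varphi_2 \mid \langle P \rangle \varphi$, with processes $P ::= \alpha \mid \alpha.P \mid P_1 + P_2 \mid P_1|P_2$, $\alpha \in {\cal N} \cup \overline{\cal N} \cup \{\tau\}$ (CCS without constants or restriction). $\overrightarrow{{\cal R}_f}(P) = \{\overrightarrow{\alpha} : P \stackrel{\overrightarrow{\alpha}}{\Rightarrow} \mathrm{Done}\}$ is the set of finite action sequences after which $P$ may successfully terminate under the CCS transition rules ($\mathrm{Done}$ = successful termination). A frame is $(W,\{R_\alpha\})$ with a binary relation per action; a model adds a valuation ${\bf V}$. Satisfaction is standard for Boolean connectives, and ${\cal M},w \Vdash \langle P \rangle \varphi$ iff there is a finite path $(v_0,\ldots,v_n)$, $n \geq 1$, with $v_0 = w$, ${\cal M},v_n \Vdash \varphi$, and some $\overrightarrow{\alpha} \in \overrightarrow{{\cal R}_f}(P)$ of length $n$ such that $(v_{i-1},v_i) \in R_\beta$ iff $(\overrightarrow{\alpha})_i = \beta$ for $1 \leq i \leq n$. $\Vdash \varphi$ means $\varphi$ holds at every state of every model. *)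

theory Defs
  imports Main
begin

text \<open>The type of names is arbitrary; the constructors keep names, co-names and the silent
  action disjoint.\<close>

datatype 'a action = Name 'a | Coname 'a | Tau

fun co :: "'a action \<Rightarrow> 'a action" where
  "co (Name a) = Coname a"
| "co (Coname a) = Name a"
| "co Tau = Tau"

datatype 'a proc =
    Act "'a action"
  | Prefix "'a action" "'a proc"
  | Sum "'a proc" "'a proc"
  | Par "'a proc" "'a proc"

text \<open>Successful termination is not itself a process of the grammar, so the target of a
  transition is either a process or \<open>Done\<close>. In a parallel composition a component that has
  terminated is dropped: \<open>Done\<close> is the unit of \<open>|\<close>, and the composition is \<open>Done\<close> when both
  components are.\<close>

datatype 'a config = Done | Proc "'a proc"

fun par_config :: "'a config \<Rightarrow> 'a config \<Rightarrow> 'a config" where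
  "par_config Done c = c"
| "par_config (Proc P) Done = Proc P"
| "par_config (Proc P) (Proc Q) = Proc (Par P Q)"

inductive step :: "'a proc \<Rightarrow> 'a action \<Rightarrow> 'a config \<Rightarrow> bool" where
  step_act: "step (Act \<alpha>) \<alpha> Done"
| step_prefix: "step (Prefix \<alpha> P) \<alpha> (Proc P)"
| step_sum1: "step P \<alpha> c \<Longrightarrow> step (Sum P Q) \<alpha> c"
| step_sum2: "step Q \<alpha> c \<Longrightarrow> step (Sum P Q) \<alpha> c"
| step_par1: "step P \<alpha> c \<Longrightarrow> step (Par P Q) \<alpha> (par_config c (Proc Q))"
| step_par2: "step Q \<alpha> c \<Longrightarrow> step (Par P Q) \<alpha> (par_config (Proc P) c)"
| step_comm: "step P l c \<Longrightarrow> step Q (co l) d \<Longrightarrow> l \<noteq> Tau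
    \<Longrightarrow> step (Par P Q) Tau (par_config c d)"

text \<open>Sequences of transitions record every action, \<open>Tau\<close> included.\<close>

inductive steps :: "'a config \<Rightarrow> 'a action list \<Rightarrow> 'a config \<Rightarrow> bool" where
  steps_refl: "steps c [] c"
| steps_step: "step P \<alpha> c \<Longrightarrow> steps c \<alpha>s d \<Longrightarrow> steps (Proc P) (\<alpha> # \<alpha>s) d"

definition Rf :: "'a proc \<Rightarrow> 'a action list set" where
  "Rf P = {\<alpha>s. steps (Proc P) \<alpha>s Done}"

datatype ('a, 'p) form =
    Atom 'p
  | Top
  | Neg "('a, 'p) form"
  | Conj "('a, 'p) form" "('a, 'p) form"
  | Dia "'a proc" "('a, 'p) form"

definition Imp :: "('a, 'p) form \<Rightarrow> ('a, 'p) form \<Rightarrow> ('a, 'p) form" where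
  "Imp \<phi> \<psi> = Neg (Conj \<phi> (Neg \<psi>))"

definition Iff :: "('a, 'p) form \<Rightarrow> ('a, 'p) form \<Rightarrow> ('a, 'p) form" where
  "Iff \<phi> \<psi> = Conj (Imp \<phi> \<psi>) (Imp \<psi> \<phi>)"

record ('w, 'a) frame =
  worlds :: "'w set"
  rel :: "'a action \<Rightarrow> ('w \<times> 'w) set"

record ('w, 'a, 'p) model = "('w, 'a) frame" +
  val :: "'p \<Rightarrow> 'w set"

definition is_model :: "('w, 'a, 'p) model \<Rightarrow> bool" where
  "is_model M \<longleftrightarrow> worlds M \<noteq> {} \<and> (\<forall>\<alpha>. rel M \<alpha> \<subseteq> worlds M \<times> worlds M)
     \<and> (\<forall>p. val M p \<subseteq> worlds M)"

text \<open>In the clause for \<open>Dia\<close>, the path \<open>(v\<^sub>0, \<dots>, v\<^sub>n)\<close> is the list \<open>v\<close>, and the \<open>i\<close>-th action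
  of \<open>\<alpha>s\<close>, counted from 1, is \<open>\<alpha>s ! (i - 1)\<close>. The equivalence is intended: the \<open>i\<close>-th step must
  be related by the \<open>i\<close>-th action and by no other.\<close>

primrec sat :: "('w, 'a, 'p) model \<Rightarrow> 'w \<Rightarrow> ('a, 'p) form \<Rightarrow> bool" where
  "sat M w (Atom p) \<longleftrightarrow> w \<in> val M p"
| "sat M w Top \<longleftrightarrow> True"
| "sat M w (Neg \<phi>) \<longleftrightarrow> \<not> sat M w \<phi>"
| "sat M w (Conj \<phi> \<psi>) \<longleftrightarrow> sat M w \<phi> \<and> sat M w \<psi>"
| "sat M w (Dia P \<phi>) \<longleftrightarrow> (\<exists>n v. n \<ge> 1 \<and> length v = Suc n \<and> set v \<subseteq> worlds M
      \<and> v ! 0 = w \<and> sat M (v ! n) \<phi>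
      \<and> (\<exists>\<alpha>s \<in> Rf P. length \<alpha>s = n
           \<and> (\<forall>i\<in>{1..n}. \<forall>\<beta>. (v ! (i - 1), v ! i) \<in> rel M \<beta> \<longleftrightarrow> \<alpha>s ! (i - 1) = \<beta>)))"

text \<open>HOL cannot quantify over types inside a formula, so validity takes the type from whose
  subsets the sets of states are drawn as a parameter. If that type is infinite, it provides
  (up to isomorphism) all finite and countable models; larger ones are covered by larger types.
  A finite type would bound the size of the models and would not express validity.\<close>

definition valid :: "'w itself \<Rightarrow> ('a, 'p) form \<Rightarrow> bool" where
  "valid _ \<phi> \<longleftrightarrow> (\<forall>M :: ('w, 'a, 'p) model. is_model M \<longrightarrow> (\<forall>w \<in> worlds M. sat M w \<phi>))"

end

theory Submission
  imports Defs
begin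

text \<open>The meaning of \<open>\<langle>P\<rangle>p\<close> depends on \<open>P\<close> only through \<open>Rf P\<close>, which gives one direction. For
  the other, a sequence of actions is turned into a finite linear model whose consecutive states
  are related exactly by the corresponding actions and whose last state is the only one that
  satisfies \<open>p\<close>. Every path from the first state to the last one spells out this very sequence, so
  \<open>\<langle>P\<rangle>p\<close> holds at the first state exactly when the sequence belongs to \<open>Rf P\<close>.\<close>

lemma sat_Iff [simp]: "sat M w (Iff \<phi> \<psi>) \<longleftrightarrow> (sat M w \<phi> \<longleftrightarrow> sat M w \<psi>)"
  by (auto simp: Iff_def Imp_def)

text \<open>Supplies the bound \<open>n \<ge> 1\<close> in the clause for
  \<open>Dia\<close>.\<close>

lemma Rf_not_Nil: "\<alpha>s \<in> Rf P \<Longrightarrow> \<alpha>s \<noteq> []"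
  unfolding Rf_def by (auto elim: steps.cases)

text \<open>Position \<open>i\<close> is encoded as the state \<open>f i\<close>, so an injective
  \<open>f\<close> places the line inside any infinite type.\<close>

definition line_model :: "(nat \<Rightarrow> 'w) \<Rightarrow> 'a action list \<Rightarrow> ('w, 'a, 'p) model" where
  "line_model f \<alpha>s = \<lparr>worlds = f ` {..length \<alpha>s},
     rel = (\<lambda>\<beta>. {(f i, f (Suc i)) | i. i < length \<alpha>s \<and> \<alpha>s ! i = \<beta>}),
     val = (\<lambda>_. {f (length \<alpha>s)})\<rparr>"

lemma line_model_sel [simp]:
  "worlds (line_model f \<alpha>s) = f ` {..length \<alpha>s}"
  "rel (line_model f \<alpha>s) \<beta> = {(f i, f (Suc i)) | i. i < length \<alpha>s \<and> \<alpha>s ! i = \<beta>}"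
  "val (line_model f \<alpha>s) p = {f (length \<alpha>s)}"
  by (simp_all add: line_model_def)

lemma is_model_line_model: "is_model (line_model f \<alpha>s)"
  by (auto simp: is_model_def)

lemma sat_line_model_Dia:
  assumes f: "inj f"
  shows "sat (line_model f \<alpha>s) (f 0) (Dia P (Atom p)) \<longleftrightarrow> \<alpha>s \<in> Rf P"
    (is "?sat \<longleftrightarrow> _")
proof
  assume \<alpha>s: "\<alpha>s \<in> Rf P"
  let ?n = "length \<alpha>s" and ?v = "map f [0..<Suc (length \<alpha>s)]"
  have nth_v: "?v ! i = f i" if "i \<le> ?n" for i
    using that by (simp add: less_Suc_eq_le del: upt_Suc)
  \<comment> \<open>As \<open>f\<close> is injective, only the edge at index \<open>j\<close> joins
    \<open>f j\<close> to \<open>f (Suc j)\<close>, so no action other than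
    \<open>\<alpha>s ! j\<close> relates them.\<close>
  have edge: "(?v ! (i - 1), ?v ! i) \<in> rel (line_model f \<alpha>s) \<beta> \<longleftrightarrow> \<alpha>s ! (i - 1) = \<beta>"
    if range: "i \<in> {1..?n}" for i \<beta>
  proof -
    obtain j where i: "i = Suc j" "j < ?n"
      using range by (cases i) auto
    show ?thesis
      using f i nth_v[of j] nth_v[of "Suc j"] by (auto simp: inj_eq simp del: upt_Suc)
  qed
  have "?n \<ge> 1"
    using Rf_not_Nil[OF \<alpha>s] by (cases \<alpha>s) auto
  moreover have "set ?v \<subseteq> worlds (line_model f \<alpha>s)"
    by auto
  moreover have "?v ! 0 = f 0" "sat (line_model f \<alpha>s) (?v ! ?n) (Atom p)"
    using nth_v[of 0] nth_v[of ?n] by simp_all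
  ultimately show ?sat
    unfolding sat.simps(5) using \<alpha>s edge
    by (intro exI[of _ ?n] exI[of _ ?v] conjI bexI[of _ \<alpha>s]) (auto simp del: upt_Suc)
next
  assume ?sat
  then obtain v \<beta>s where v0: "v ! 0 = f 0" and vn: "v ! length \<beta>s = f (length \<alpha>s)"
    and \<beta>s: "\<beta>s \<in> Rf P"
    and edges: "\<forall>i\<in>{1..length \<beta>s}. \<forall>\<beta>.
      (v ! (i - 1), v ! i) \<in> rel (line_model f \<alpha>s) \<beta> \<longleftrightarrow> \<beta>s ! (i - 1) = \<beta>"
    unfolding sat.simps by auto
  \<comment> \<open>The equivalence at position \<open>Suc i\<close>, with
    \<open>\<beta>s ! i\<close> for \<beta>, yields an edge of the line.\<close>
  have edge: "\<exists>j. v ! i = f j \<and> v ! Suc i = f (Suc j) \<and> j < length \<alpha>s \<and> \<alpha>s ! j = \<beta>s ! i"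
    if "i < length \<beta>s" for i
    using that bspec[OF edges, of "Suc i"] by auto
  \<comment> \<open>Each state has at most one successor, so a path from \<open>f 0\<close> has to
    follow the line.\<close>
  have path: "v ! i = f i" if "i \<le> length \<beta>s" for i
    using that
  proof (induction i)
    case (Suc i)
    then show ?case
      using edge[of i] f by (auto simp: inj_eq)
  qed (simp add: v0)
  \<comment> \<open>The atom holds at the end of the line only, so the path cannot stop
    early.\<close>
  have "length \<beta>s = length \<alpha>s"
    using vn path[of "length \<beta>s"] f by (simp add: inj_eq)
  moreover have "\<beta>s ! i = \<alpha>s ! i" if "i < length \<beta>s" for i
    using edge[OF that] path[of i] that f by (auto simp: inj_eq)
  ultimately have "\<beta>s = \<alpha>s"
    by (simp add: list_eq_iff_nth_eq)
  with \<beta>s show "\<alpha>s \<in> Rf P"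
    by simp
qed

theorem theorem3p5:
  fixes P Q :: "'a proc" and p :: 'p
  assumes "infinite (UNIV :: 'w set)"
  shows "Rf P = Rf Q \<longleftrightarrow>
    valid TYPE('w) (Iff (Dia P (Atom p)) (Dia Q (Atom p)) :: ('a, 'p) form)"
proof
  assume "Rf P = Rf Q"
  then show "valid TYPE('w) (Iff (Dia P (Atom p)) (Dia Q (Atom p)) :: ('a, 'p) form)"
    by (simp add: valid_def)
next
  assume valid: "valid TYPE('w) (Iff (Dia P (Atom p)) (Dia Q (Atom p)) :: ('a, 'p) form)"
  \<comment> \<open>One injection serves the lines of all lengths.\<close>
  obtain f :: "nat \<Rightarrow> 'w" where f: "inj f"
    using infinite_countable_subset[OF assms] by auto
  have "\<alpha>s \<in> Rf P \<longleftrightarrow> \<alpha>s \<in> Rf Q" for \<alpha>s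
  proof -
    let ?M = "line_model f \<alpha>s :: ('w, 'a, 'p) model"
    have "sat ?M (f 0) (Iff (Dia P (Atom p)) (Dia Q (Atom p)))"
      using valid is_model_line_model[of f \<alpha>s] unfolding valid_def
      by (auto simp del: sat_Iff sat.simps)
    then show ?thesis
      by (simp only: sat_Iff sat_line_model_Dia[OF f])
  qed
  then show "Rf P = Rf Q"
    by blast
qed

end
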